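(* Let $X$ be a nonempty set, let $d\in\mathbb{N}$, and let $\mathbf{K}:X\times X\to\mathbb{R}^{d\times d}$ be an admissible multi-task kernel. Assume that all the minimal norm interpolation problems and all the regularization network problems on $\mathcal{B}_{\mathbf{K}}$ described in the context have minimizers in $\mathcal{B}_{\mathbf{K}}$. Then $\mathcal{B}_{\mathbf{K}}$ satisfies the linear representer theorem for regularization network if and only if it satisfies the linear representer theorem for minimal norm interpolation.
   Context: $\mathbb{N}=\{1,2,\dots\}$, $\mathbb{N}_m=\{1,\dots,m\}$, $\mathbb{R}_+=[0,\infty)$. For a vector, $\|\cdot\|_p$ is the $\ell^p$ norm; for a matrix, $\|\cdot\|_p$ is the $\ell^p$-induced operator norm. For a nonempty set $\Omega$, $\ell^1_d(\Omega)=\{\boldsymbol{c}=(\boldsymbol{c}_t\in\mathbb{R}^d:t\in\Omega): \|\boldsymbol{c}\|_{\ell^1_d(\Omega)}=\sum_{t\in\Omega}\|\boldsymbol{c}_t\|_1<\infty\}$, and $\mathrm{supp}\,\boldsymbol{c}=\{t:\boldsymbol{c}_t\ne0\}$. Admissible multi-task kernel: a function $\mathbf{K}:X\times X\to\mathbb{R}^{d\times d}$ with $\mathbf{K}(x,x')^\top=\mathbf{K}(x,x')$ for all $x,x'\in X$ such that (A1) for all $m\in\mathbb{N}$ and pairwise distinct $x_1,\dots,x_m\in X$, the $md\times md$ block matrix $\mathbf{K}[\mathbf{x}]$ whose $(j,k)$ block is $\mathbf{K}(x_k,x_j)$ is non-singular; (A2) there is $\kappa>0$ with $\|\mathbf{K}(x,x')\|_1\le\kappa$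 for all $x,x'\in X$; (A3) for all pairwise distinct $x_j\in X$, $j\in\mathbb{N}$, and $(\boldsymbol{c}_j)_{j\in\mathbb{N}}\in\ell^1_d(\mathbb{N})$, if $\sum_{j\in\mathbb{N}}\mathbf{K}(x_j,x)\boldsymbol{c}_j=0$ for all $x\in X$, then $\boldsymbol{c}_j=0$ for all $j$. The space $\mathcal{B}_{\mathbf{K}}=\{\sum_{x\in\mathrm{supp}\,\boldsymbol{c}}\mathbf{K}(x,\cdot)\boldsymbol{c}_x:\boldsymbol{c}\in\ell^1_d(X)\}$ carries the norm $\|\sum_{x\in\mathrm{supp}\,\boldsymbol{c}}\mathbf{K}(x,\cdot)\boldsymbol{c}_x\|_{\mathcal{B}_{\mathbf{K}}}=\|\boldsymbol{c}\|_{\ell^1_d(X)}$. For sampling data $\{(x_j,\boldsymbol{y}_j):j\in\mathbb{N}_m\}\subseteq X\times\mathbb{R}^d$ with $x_j$ pairwise distinct, write $\mathbf{x}=\{x_j\}$, $\boldsymbol{y}=(\boldsymbol{y}_1,\dots,\boldsymbol{y}_m)\in\mathbb{R}^{md}$, $f(\mathbf{x})=(f(x_1),\dots,f(x_m))\in\mathbb{R}^{md}$, $\mathcal{I}_{\mathbf{x}}(\boldsymbol{y})=\{f\in\mathcal{B}_{\mathbf{K}}:f(\mathbf{x})=\boldsymbol{y}\}$, $\mathcal{S}^{\mathbf{x}}=\{\sum_{j=1}^m\mathbf{K}(x_j,\cdot)\boldsymbol{c}_j:\boldsymbol{c}_j\in\mathbb{R}^d\}$. Minimal norm interpolation problem: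 $\min_{f\in\mathcal{I}_{\mathbf{x}}(\boldsymbol{y})}\|f\|_{\mathcal{B}_{\mathbf{K}}}$. $\mathcal{B}_{\mathbf{K}}$ satisfies the linear representer theorem for minimal norm interpolation if for every $m\in\mathbb{N}$ and all such sampling data this problem has a minimizer in $\mathcal{S}^{\mathbf{x}}$. Regularization network problem: $\min_{f\in\mathcal{B}_{\mathbf{K}}}L(f(\mathbf{x}),\boldsymbol{y})+\lambda\phi(\|f\|_{\mathcal{B}_{\mathbf{K}}})$, where $\lambda>0$, $L:\mathbb{R}^{md}\times\mathbb{R}^{md}\to\mathbb{R}_+$ is continuous with $L(\boldsymbol{t},\boldsymbol{t})=0$ for all $\boldsymbol{t}\in\mathbb{R}^{md}$, and $\phi:\mathbb{R}_+\to\mathbb{R}_+$ is continuous, non-decreasing, with $\lim_{t\to+\infty}\phi(t)=+\infty$. $\mathcal{B}_{\mathbf{K}}$ satisfies the linear representer theorem for regularization network if for every $m\in\mathbb{N}$, all such sampling data, all such $L$ and $\phi$, and every $\lambda>0$, this problem has a minimizer in $\mathcal{S}^{\mathbf{x}}$. *)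

theory Defs
  imports "HOL-Analysis.Analysis"
begin

text \<open>The space \<open>\<real>\<^sup>d\<close> is \<open>real ^ 'd\<close>, whose library norm is the Euclidean one;
  hence the \<open>\<ell>\<^sup>1\<close> norm and the operator norm it induces are introduced here.\<close>

definition norm1 :: "real ^ 'd \<Rightarrow> real"
  where "norm1 v = (\<Sum>i\<in>UNIV. \<bar>v $ i\<bar>)"

text \<open>Same shape as \<^const>\<open>onorm\<close>; the vector \<open>v = 0\<close> contributes \<open>0 / 0 = 0\<close>.\<close>

definition opnorm1 :: "real ^ 'd ^ 'd \<Rightarrow> real"
  where "opnorm1 A = (SUP v. norm1 (A *v v) / norm1 v)"

text \<open>A family indexed by \<open>\<Omega>\<close> is a function whose values outside \<open>\<Omega>\<close> are
  irrelevant.\<close>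

definition l1_space :: "'i set \<Rightarrow> ('i \<Rightarrow> real ^ 'd) set"
  where "l1_space \<Omega> = {c. (\<lambda>t. norm1 (c t)) summable_on \<Omega>}"

definition l1_norm :: "'i set \<Rightarrow> ('i \<Rightarrow> real ^ 'd) \<Rightarrow> real"
  where "l1_norm \<Omega> c = (\<Sum>\<^sub>\<infinity>t\<in>\<Omega>. norm1 (c t))"

definition supp :: "'i set \<Rightarrow> ('i \<Rightarrow> real ^ 'd) \<Rightarrow> 'i set"
  where "supp \<Omega> c = {t \<in> \<Omega>. c t \<noteq> 0}"

text \<open>Invertibility of a square matrix whose rows and columns are indexed by a finite set
  \<open>I\<close>: the definition of \<^const>\<open>invertible\<close>, for an index set instead of an index type.\<close>

definition nonsingular_on :: "'i set \<Rightarrow> ('i \<Rightarrow> 'i \<Rightarrow> real) \<Rightarrow> bool"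
  where "nonsingular_on I A \<longleftrightarrow>
    (\<exists>B. (\<forall>p\<in>I. \<forall>q\<in>I. (\<Sum>r\<in>I. A p r * B r q) = (if p = q then 1 else 0)) \<and>
         (\<forall>p\<in>I. \<forall>q\<in>I. (\<Sum>r\<in>I. B p r * A r q) = (if p = q then 1 else 0)))"

text \<open>The \<open>md \<times> md\<close> matrix \<open>K[x]\<close>, with rows and columns indexed by
  \<open>{1..m} \<times> UNIV\<close>: the entry at \<open>((j, a), (k, b))\<close> is entry \<open>(a, b)\<close> of the
  \<open>(j, k)\<close> block \<open>K(x\<^sub>k, x\<^sub>j)\<close>.\<close>

definition kernel_matrix ::
    "('x \<Rightarrow> 'x \<Rightarrow> real ^ 'd ^ 'd) \<Rightarrow> (nat \<Rightarrow> 'x) \<Rightarrow> nat \<times> 'd \<Rightarrow> nat \<times> 'd \<Rightarrow> real"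
  where "kernel_matrix K x = (\<lambda>(j, a) (k, b). K (x k) (x j) $ a $ b)"

definition distinct_points :: "'x set \<Rightarrow> nat set \<Rightarrow> (nat \<Rightarrow> 'x) \<Rightarrow> bool"
  where "distinct_points X J x \<longleftrightarrow> x ` J \<subseteq> X \<and> inj_on x J"

definition admissible_kernel :: "'x set \<Rightarrow> ('x \<Rightarrow> 'x \<Rightarrow> real ^ 'd ^ 'd) \<Rightarrow> bool"
  where "admissible_kernel X K \<longleftrightarrow>
    (\<forall>x\<in>X. \<forall>x'\<in>X. transpose (K x x') = K x x') \<and>
    (\<forall>m\<ge>1. \<forall>x. distinct_points X {1..m} x \<longrightarrow>
        nonsingular_on ({1..m} \<times> UNIV) (kernel_matrix K x)) \<and>
    (\<exists>\<kappa>>0. \<forall>x\<in>X. \<forall>x'\<in>X. opnorm1 (K x x') \<le> \<kappa>) \<and>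
    (\<forall>x c. distinct_points X {1..} x \<longrightarrow> c \<in> l1_space {1..} \<longrightarrow>
        (\<forall>z\<in>X. (\<Sum>\<^sub>\<infinity>j\<in>{1..}. K (x j) z *v c j) = 0) \<longrightarrow>
        (\<forall>j\<ge>1. c j = 0))"

text \<open>Functions on \<open>X\<close> are \<^const>\<open>extensional\<close>, so that equality of functions is equality
  on \<open>X\<close>.\<close>

definition kernel_sum ::
    "'x set \<Rightarrow> ('x \<Rightarrow> 'x \<Rightarrow> real ^ 'd ^ 'd) \<Rightarrow> ('x \<Rightarrow> real ^ 'd) \<Rightarrow> 'x \<Rightarrow> real ^ 'd"
  where "kernel_sum X K c = (\<lambda>z\<in>X. \<Sum>\<^sub>\<infinity>x\<in>supp X c. K x z *v c x)"

definition BK :: "'x set \<Rightarrow> ('x \<Rightarrow> 'x \<Rightarrow> real ^ 'd ^ 'd) \<Rightarrow> ('x \<Rightarrow> real ^ 'd) set"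
  where "BK X K = kernel_sum X K ` l1_space X"

text \<open>For admissible \<open>K\<close> the coefficients of \<open>f \<in> B\<^sub>K\<close> are determined on \<open>X\<close> by \<open>f\<close>, so
  the description below is unique.\<close>

definition BK_norm ::
    "'x set \<Rightarrow> ('x \<Rightarrow> 'x \<Rightarrow> real ^ 'd ^ 'd) \<Rightarrow> ('x \<Rightarrow> real ^ 'd) \<Rightarrow> real"
  where "BK_norm X K f =
    (THE r. \<exists>c\<in>l1_space X. f = kernel_sum X K c \<and> r = l1_norm X c)"

text \<open>The number \<open>m\<close> of sampling points is quantified inside the properties below, so it
  cannot be a type.  A vector of \<open>\<real>\<^sup>m\<^sup>d\<close> is its family of \<open>m\<close> blocks in \<open>\<real>\<^sup>d\<close>, extensional
  on \<open>{1..m}\<close>; the topology is the subspace topology of the product topology on functions,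
  which is the usual topology of \<open>\<real>\<^sup>m\<^sup>d\<close>.\<close>

definition block_vecs :: "nat \<Rightarrow> (nat \<Rightarrow> real ^ 'd) set"
  where "block_vecs m = {1..m} \<rightarrow>\<^sub>E UNIV"

definition sampling_data :: "'x set \<Rightarrow> nat \<Rightarrow> (nat \<Rightarrow> 'x) \<Rightarrow> (nat \<Rightarrow> real ^ 'd) \<Rightarrow> bool"
  where "sampling_data X m x y \<longleftrightarrow>
    m \<ge> 1 \<and> distinct_points X {1..m} x \<and> y \<in> block_vecs m"

definition sample :: "nat \<Rightarrow> (nat \<Rightarrow> 'x) \<Rightarrow> ('x \<Rightarrow> real ^ 'd) \<Rightarrow> nat \<Rightarrow> real ^ 'd"
  where "sample m x f = (\<lambda>j\<in>{1..m}. f (x j))"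

definition interpolants ::
    "'x set \<Rightarrow> ('x \<Rightarrow> 'x \<Rightarrow> real ^ 'd ^ 'd) \<Rightarrow> nat \<Rightarrow> (nat \<Rightarrow> 'x) \<Rightarrow> (nat \<Rightarrow> real ^ 'd)
      \<Rightarrow> ('x \<Rightarrow> real ^ 'd) set"
  where "interpolants X K m x y = {f \<in> BK X K. sample m x f = y}"

definition kernel_span ::
    "'x set \<Rightarrow> ('x \<Rightarrow> 'x \<Rightarrow> real ^ 'd ^ 'd) \<Rightarrow> nat \<Rightarrow> (nat \<Rightarrow> 'x) \<Rightarrow> ('x \<Rightarrow> real ^ 'd) set"
  where "kernel_span X K m x =
    range (\<lambda>c :: nat \<Rightarrow> real ^ 'd. \<lambda>z\<in>X. \<Sum>j=1..m. K (x j) z *v c j)"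

definition min_norm_minimizer ::
    "'x set \<Rightarrow> ('x \<Rightarrow> 'x \<Rightarrow> real ^ 'd ^ 'd) \<Rightarrow> nat \<Rightarrow> (nat \<Rightarrow> 'x) \<Rightarrow> (nat \<Rightarrow> real ^ 'd)
      \<Rightarrow> ('x \<Rightarrow> real ^ 'd) \<Rightarrow> bool"
  where "min_norm_minimizer X K m x y f \<longleftrightarrow>
    is_arg_min (BK_norm X K) (\<lambda>g. g \<in> interpolants X K m x y) f"

definition loss_function ::
    "nat \<Rightarrow> ((nat \<Rightarrow> real ^ 'd) \<Rightarrow> (nat \<Rightarrow> real ^ 'd) \<Rightarrow> real) \<Rightarrow> bool"
  where "loss_function m L \<longleftrightarrow>
    continuous_on (block_vecs m \<times> block_vecs m) (\<lambda>(s, t). L s t) \<and>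
    (\<forall>s\<in>block_vecs m. \<forall>t\<in>block_vecs m. L s t \<ge> 0) \<and>
    (\<forall>t\<in>block_vecs m. L t t = 0)"

definition regularizer :: "(real \<Rightarrow> real) \<Rightarrow> bool"
  where "regularizer \<phi> \<longleftrightarrow>
    continuous_on {0..} \<phi> \<and> (\<forall>t\<ge>0. \<phi> t \<ge> 0) \<and> mono_on {0..} \<phi> \<and>
    filterlim \<phi> at_top at_top"

definition reg_network_minimizer ::
    "'x set \<Rightarrow> ('x \<Rightarrow> 'x \<Rightarrow> real ^ 'd ^ 'd) \<Rightarrow> nat \<Rightarrow> (nat \<Rightarrow> 'x) \<Rightarrow> (nat \<Rightarrow> real ^ 'd)
      \<Rightarrow> ((nat \<Rightarrow> real ^ 'd) \<Rightarrow> (nat \<Rightarrow> real ^ 'd) \<Rightarrow> real) \<Rightarrow> (real \<Rightarrow> real) \<Rightarrow> real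
      \<Rightarrow> ('x \<Rightarrow> real ^ 'd) \<Rightarrow> bool"
  where "reg_network_minimizer X K m x y L \<phi> lam f \<longleftrightarrow>
    is_arg_min (\<lambda>g. L (sample m x g) y + lam * \<phi> (BK_norm X K g)) (\<lambda>g. g \<in> BK X K) f"

definition representer_min_norm :: "'x set \<Rightarrow> ('x \<Rightarrow> 'x \<Rightarrow> real ^ 'd ^ 'd) \<Rightarrow> bool"
  where "representer_min_norm X K \<longleftrightarrow>
    (\<forall>m x y. sampling_data X m x y \<longrightarrow>
      (\<exists>f \<in> kernel_span X K m x. min_norm_minimizer X K m x y f))"

definition representer_reg_network :: "'x set \<Rightarrow> ('x \<Rightarrow> 'x \<Rightarrow> real ^ 'd ^ 'd) \<Rightarrow> bool"
  where "representer_reg_network X K \<longleftrightarrow>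
    (\<forall>m x y L \<phi> lam.
      sampling_data X m x y \<longrightarrow> loss_function m L \<longrightarrow> regularizer \<phi> \<longrightarrow> lam > 0 \<longrightarrow>
      (\<exists>f \<in> kernel_span X K m x. reg_network_minimizer X K m x y L \<phi> lam f))"

end

theory Submission
  imports Defs
begin

text \<open>If every minimal norm interpolation problem has a minimizer in \<open>S\<^sup>x\<close>, replace a minimizer
  \<open>f\<close> of the regularization network by a minimal norm interpolant in \<open>S\<^sup>x\<close> of the values of
  \<open>f\<close>: the loss is unchanged and the norm does not grow.

  For the converse no limit \<open>\<lambda> \<rightarrow> 0\<close> is needed, because an exact penalty is available.
  Take \<open>L(s, t) = \<parallel>K[x]\<^sup>-\<^sup>1 (s - t)\<parallel>\<^sub>1\<close>, \<open>\<phi>(t) = t\<close> and \<open>\<lambda> = 1\<close>, and let \<open>g \<in> S\<^sup>x\<close>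
  with coefficients \<open>b\<close> minimize the resulting problem. The interpolant in \<open>S\<^sup>x\<close> has
  coefficients \<open>c = K[x]\<^sup>-\<^sup>1 y\<close>, so \<open>L(g(x), y) = \<parallel>b - c\<parallel>\<^sub>1\<close>, and for every interpolant
  \<open>h\<close> of \<open>y\<close> we get \<open>\<parallel>c\<parallel>\<^sub>1 \<le> \<parallel>b - c\<parallel>\<^sub>1 + \<parallel>b\<parallel>\<^sub>1 \<le> L(h(x), y) + \<parallel>h\<parallel> = \<parallel>h\<parallel>\<close>.\<close>

section \<open>The \<open>\<ell>\<^sup>1\<close> norm and its operator norm\<close>

lemma norm1_nonneg: "norm1 v \<ge> 0"
  by (simp add: norm1_def sum_nonneg)

lemma norm1_0 [simp]: "norm1 0 = 0"
  by (simp add: norm1_def)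

lemma norm1_diff_le: "norm1 (u - v) \<le> norm1 u + norm1 v"
  by (auto simp: norm1_def sum.distrib [symmetric] intro!: sum_mono)

lemma norm_le_norm1: "norm v \<le> norm1 v"
  by (simp add: norm1_def norm_le_l1_cart)

lemma norm1_eq_0_iff: "norm1 v = 0 \<longleftrightarrow> v = 0"
  by (simp add: norm1_def sum_nonneg_eq_0_iff vec_eq_iff)

lemma component_le_norm1: "\<bar>v $ i\<bar> \<le> norm1 v"
  unfolding norm1_def by (rule member_le_sum) auto

text \<open>This crude bound by the sum of all entries serves to make the quotients defining
  \<open>opnorm1\<close> bounded above: without boundedness a real supremum need not dominate its
  members.\<close>

lemma norm1_matrix_vector_le_sum:
  "norm1 (A *v v) \<le> (\<Sum>i\<in>UNIV. \<Sum>j\<in>UNIV. \<bar>A $ i $ j\<bar>) * norm1 v"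
proof -
  have "\<bar>(A *v v) $ i\<bar> \<le> (\<Sum>j\<in>UNIV. \<bar>A $ i $ j\<bar> * norm1 v)" for i
    unfolding matrix_vector_mult_def
    by (auto simp: abs_mult component_le_norm1
        intro!: order_trans [OF sum_abs] sum_mono mult_left_mono)
  then show ?thesis
    unfolding norm1_def [of "A *v v"] sum_distrib_right by (rule sum_mono)
qed

lemma norm1_matrix_vector_le: "norm1 (A *v v) \<le> opnorm1 A * norm1 v"
proof (cases "v = 0")
  case False
  then have pos: "norm1 v > 0"
    using norm1_nonneg [of v] norm1_eq_0_iff [of v] by linarith
  have "norm1 (A *v w) / norm1 w \<le> (\<Sum>i\<in>UNIV. \<Sum>j\<in>UNIV. \<bar>A $ i $ j\<bar>)" for w
  proof (cases "w = 0")
    case False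
    then have "norm1 w > 0"
      using norm1_nonneg [of w] norm1_eq_0_iff [of w] by linarith
    then show ?thesis
      using norm1_matrix_vector_le_sum [of A w] by (simp add: divide_le_eq)
  qed (simp add: sum_nonneg)
  then have "bdd_above (range (\<lambda>w. norm1 (A *v w) / norm1 w))"
    by (intro bdd_aboveI) auto
  then have "norm1 (A *v v) / norm1 v \<le> opnorm1 A"
    unfolding opnorm1_def by (intro cSUP_upper) auto
  then show ?thesis
    using pos by (simp add: divide_le_eq)
qed simp

lemma l1_space_diff:
  assumes "c \<in> l1_space \<Omega>" "c' \<in> l1_space \<Omega>"
  shows "(\<lambda>t. c t - c' t) \<in> l1_space \<Omega>"
proof -
  have "(\<lambda>t. norm1 (c t) + norm1 (c' t)) summable_on \<Omega>"
    using assms by (auto simp: l1_space_def intro: summable_on_add)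
  then show ?thesis
    unfolding l1_space_def mem_Collect_eq
    by (rule summable_on_comparison_test) (auto simp: norm1_nonneg norm1_diff_le)
qed

lemma countable_supp:
  assumes "c \<in> l1_space \<Omega>"
  shows "countable (supp \<Omega> c)"
proof -
  have "countable {t \<in> \<Omega>. norm1 (c t) \<noteq> 0}"
    using assms by (intro summable_countable_real) (simp add: l1_space_def)
  then show ?thesis
    by (simp add: supp_def norm1_eq_0_iff)
qed

section \<open>Kernel matrices\<close>

text \<open>Bridge between scalar and block notation: a block vector \<open>c\<close> is flattened
  to \<open>q \<mapsto> c (fst q) $ snd q\<close>, and row \<open>(j, a)\<close> of K[x] yields
  component \<open>a\<close> of the kernel combination at \<open>x j\<close>.\<close>

lemma kernel_matrix_mult:
  "(\<Sum>q\<in>{1..m} \<times> UNIV. kernel_matrix K x (j, a) q * c (fst q) $ snd q)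
    = (\<Sum>k=1..m. K (x k) (x j) *v c k) $ a"
  by (simp add: sum.cartesian_product' kernel_matrix_def matrix_vector_mult_def)

text \<open>Reassociating the double sums turns the matrix identities into statements about vectors.
  The left inverse recovers coefficients from samples; the right inverse produces an
  interpolant.\<close>

lemma nonsingular_on_inverse:
  assumes "nonsingular_on I A" "finite I"
  obtains B where
    "\<And>v p. p \<in> I \<Longrightarrow> (\<Sum>q\<in>I. B p q * (\<Sum>r\<in>I. A q r * v r)) = v p"
    "\<And>v p. p \<in> I \<Longrightarrow> (\<Sum>q\<in>I. A p q * (\<Sum>r\<in>I. B q r * v r)) = v p"
proof -
  have assoc: "(\<Sum>q\<in>I. M p q * (\<Sum>r\<in>I. N q r * v r)) = v p"
    if "\<And>q. q \<in> I \<Longrightarrow> (\<Sum>r\<in>I. M p r * N r q) = (if p = q then 1 else 0)" "p \<in> I"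
    for M N :: "'a \<Rightarrow> 'a \<Rightarrow> real" and v p
  proof -
    have "(\<Sum>q\<in>I. M p q * (\<Sum>r\<in>I. N q r * v r)) = (\<Sum>r\<in>I. (\<Sum>q\<in>I. M p q * N q r) * v r)"
      unfolding sum_distrib_left sum_distrib_right
      by (subst sum.swap) (simp add: mult.assoc)
    also have "\<dots> = (\<Sum>r\<in>I. if p = r then v r else 0)"
      using that by (intro sum.cong) auto
    also have "\<dots> = v p"
      using that assms(2) by simp
    finally show ?thesis .
  qed
  from assms(1) obtain B where
    "\<forall>p\<in>I. \<forall>q\<in>I. (\<Sum>r\<in>I. A p r * B r q) = (if p = q then 1 else 0)"
    "\<forall>p\<in>I. \<forall>q\<in>I. (\<Sum>r\<in>I. B p r * A r q) = (if p = q then 1 else 0)"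
    unfolding nonsingular_on_def by auto
  then show ?thesis
    by (intro that [of B] assoc) auto
qed

lemma admissible_nonsingular:
  "admissible_kernel X K \<Longrightarrow> m \<ge> 1 \<Longrightarrow> distinct_points X {1..m} x \<Longrightarrow>
    nonsingular_on ({1..m} \<times> UNIV) (kernel_matrix K x)"
  unfolding admissible_kernel_def by blast

section \<open>The space \<open>B\<^sub>K\<close>\<close>

lemma kernel_sum_apply:
  "z \<in> X \<Longrightarrow> kernel_sum X K c z = (\<Sum>\<^sub>\<infinity>x\<in>X. K x z *v c x)"
  by (auto simp: kernel_sum_def supp_def intro!: infsum_cong_neutral)

text \<open>By (A2) the terms are dominated by \<kappa> times the summable family
  \<open>norm1 (c x)\<close>.\<close>

lemma kernel_summable:
  assumes "admissible_kernel X K" "c \<in> l1_space X" "z \<in> X"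
  shows "(\<lambda>x. K x z *v c x) summable_on X"
proof -
  obtain \<kappa> where \<kappa>: "\<And>x x'. x \<in> X \<Longrightarrow> x' \<in> X \<Longrightarrow> opnorm1 (K x x') \<le> \<kappa>"
    using assms(1) unfolding admissible_kernel_def by blast
  have le: "norm (K x z *v c x) \<le> \<kappa> * norm1 (c x)" if "x \<in> X" for x
    using norm_le_norm1 [of "K x z *v c x"] norm1_matrix_vector_le [of "K x z" "c x"]
      mult_right_mono [OF \<kappa> [OF that assms(3)] norm1_nonneg [of "c x"]] by linarith
  have "(\<lambda>x. \<kappa> * norm1 (c x)) summable_on X"
    using assms(2) by (simp add: l1_space_def summable_on_cmult_right)
  then have "(\<lambda>x. norm (K x z *v c x)) summable_on X"
    by (rule summable_on_comparison_test) (simp_all add: le)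
  then show ?thesis
    by (rule abs_summable_summable)
qed

text \<open>Condition (A3) speaks about infinite sequences of points only and is void when \<open>X\<close> is
  finite; in that case (A1) gives the independence.\<close>

lemma kernel_independent:
  assumes adm: "admissible_kernel X K" and e: "e \<in> l1_space X"
    and zero: "\<And>z. z \<in> X \<Longrightarrow> (\<Sum>\<^sub>\<infinity>x\<in>X. K x z *v e x) = 0"
    and t: "t \<in> X"
  shows "e t = 0"
proof (cases "finite X")
  case True
  define m where "m = card X"
  obtain x where x: "bij_betw x {1..m} X"
    using ex_bij_betw_nat_finite_1 [OF True] m_def by blast
  have m: "m \<ge> 1"
    using True t by (auto simp: m_def Suc_le_eq card_gt_0_iff)
  have "distinct_points X {1..m} x"
    using x by (auto simp: distinct_points_def bij_betw_def)
  then have "nonsingular_on ({1..m} \<times> UNIV) (kernel_matrix K x)"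
    by (rule admissible_nonsingular [OF adm m])
  then obtain B where B: "\<And>v p. p \<in> {1..m} \<times> UNIV \<Longrightarrow> (\<Sum>q\<in>{1..m} \<times> UNIV. B p q *
      (\<Sum>r\<in>{1..m} \<times> UNIV. kernel_matrix K x q r * v r)) = v p"
    by (rule nonsingular_on_inverse) auto
  \<comment> \<open>With \<open>x\<close> enumerating all of X, the hypothesis says that K[x] maps
    the flattened \<open>e\<close> to 0, and the left inverse \<open>B\<close> then gives
    \<open>e = 0\<close>.\<close>
  have "(\<Sum>k=1..m. K (x k) z *v e (x k)) = 0" if "z \<in> X" for z
    using zero [OF that] True sum.reindex_bij_betw [OF x, of "\<lambda>u. K u z *v e u"] by simp
  moreover have "x j \<in> X" if "j \<in> {1..m}" for j
    using x that by (auto simp: bij_betw_def)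
  ultimately have 0: "(\<Sum>r\<in>{1..m} \<times> UNIV. kernel_matrix K x q r * e (x (fst r)) $ snd r) = 0"
    if "q \<in> {1..m} \<times> UNIV" for q
    using that kernel_matrix_mult [of K x "fst q" "snd q" "\<lambda>k. e (x k)" m]
    by (cases q) auto
  obtain k where k: "k \<in> {1..m}" "t = x k"
    using x t by (auto simp: bij_betw_def)
  have "e (x k) $ b = 0" for b
    using B [of "(k, b)" "\<lambda>r. e (x (fst r)) $ snd r"] k 0 by simp
  then show ?thesis
    using k by (simp add: vec_eq_iff)
next
  case False
  obtain S0 where S0: "S0 \<subseteq> X" "countable S0" "infinite S0"
    using infinite_countable_subset' [OF False] by blast
  \<comment> \<open>(A3) needs an infinite sequence of distinct points, while the support may be
    finite. Adjoining \<open>S0\<close> only adds points with coefficient 0 to the support.\<close>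
  define S where "S = S0 \<union> supp X e"
  have S: "S \<subseteq> X" "countable S" "infinite S"
    using S0 countable_supp [OF e] by (auto simp: S_def supp_def)
  \<comment> \<open>The shift is needed because \<open>from_nat_into\<close> enumerates from 0 and
    (A3) from 1.\<close>
  have "bij_betw (from_nat_into S \<circ> (\<lambda>j. j - 1)) {1..} S"
  proof (rule bij_betw_trans)
    show "bij_betw (\<lambda>j. j - 1) {1..} (UNIV :: nat set)"
      by (rule bij_betw_byWitness [where f' = Suc]) auto
    show "bij_betw (from_nat_into S) UNIV S"
      using S by (intro bij_betw_from_nat_into)
  qed
  then obtain x where x: "bij_betw x {1::nat..} S"
    by blast
  have "distinct_points X {1..} x"
    using x S by (auto simp: distinct_points_def bij_betw_def)
  moreover have "(\<lambda>j. e (x j)) \<in> l1_space {1..}"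
  proof -
    have "(\<lambda>t. norm1 (e t)) summable_on S"
      using e S(1) by (auto simp: l1_space_def intro: summable_on_subset_banach)
    then show ?thesis
      using summable_on_reindex_bij_betw [OF x, of "\<lambda>t. norm1 (e t)"] by (simp add: l1_space_def)
  qed
  moreover have "(\<Sum>\<^sub>\<infinity>j\<in>{1..}. K (x j) z *v e (x j)) = 0" if "z \<in> X" for z
  proof -
    have "(\<Sum>\<^sub>\<infinity>j\<in>{1..}. K (x j) z *v e (x j)) = (\<Sum>\<^sub>\<infinity>u\<in>S. K u z *v e u)"
      by (rule infsum_reindex_bij_betw [OF x])
    also have "\<dots> = (\<Sum>\<^sub>\<infinity>u\<in>X. K u z *v e u)"
      using S(1) by (intro infsum_cong_neutral) (auto simp: S_def supp_def)
    finally show ?thesis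
      using zero [OF that] by simp
  qed
  ultimately have "\<forall>j\<ge>1. e (x j) = 0"
    using adm unfolding admissible_kernel_def by blast
  then have "e u = 0" if "u \<in> S" for u
    using x that by (auto simp: bij_betw_def)
  then show ?thesis
    using t by (auto simp: S_def supp_def)
qed

lemma kernel_sum_unique:
  assumes adm: "admissible_kernel X K" and c: "c \<in> l1_space X" "c' \<in> l1_space X"
    and eq: "kernel_sum X K c = kernel_sum X K c'" and "t \<in> X"
  shows "c t = c' t"
proof -
  have "(\<Sum>\<^sub>\<infinity>x\<in>X. K x z *v (c x - c' x)) = 0" if z: "z \<in> X" for z
  proof -
    have "(\<Sum>\<^sub>\<infinity>x\<in>X. K x z *v (c x - c' x)) + (\<Sum>\<^sub>\<infinity>x\<in>X. K x z *v c' x) =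
        (\<Sum>\<^sub>\<infinity>x\<in>X. K x z *v (c x - c' x) + K x z *v c' x)"
      using kernel_summable [OF adm l1_space_diff [OF c] z] kernel_summable [OF adm c(2) z]
      by (rule infsum_add [symmetric])
    also have "\<dots> = (\<Sum>\<^sub>\<infinity>x\<in>X. K x z *v c' x)"
      using fun_cong [OF eq, of z] z by (simp add: kernel_sum_apply matrix_vector_mult_diff_distrib)
    finally show ?thesis
      by simp
  qed
  then show ?thesis
    using kernel_independent [OF adm l1_space_diff [OF c] _ \<open>t \<in> X\<close>] by simp
qed

text \<open>All representations of a function have the same coefficients on X, hence the same norm,
  so the definite description in \<open>BK_norm\<close> denotes.\<close>

lemma BK_norm_kernel_sum:
  assumes "admissible_kernel X K" "c \<in> l1_space X"
  shows "BK_norm X K (kernel_sum X K c) = l1_norm X c"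
proof -
  have "l1_norm X c' = l1_norm X c"
    if "c' \<in> l1_space X" "kernel_sum X K c = kernel_sum X K c'" for c'
    unfolding l1_norm_def
    by (rule infsum_cong) (use kernel_sum_unique [OF assms(1,2) that] in simp)
  then show ?thesis
    unfolding BK_norm_def using assms(2) by (intro the_equality) blast+
qed

lemma BK_norm_nonneg:
  assumes "admissible_kernel X K" "f \<in> BK X K"
  shows "BK_norm X K f \<ge> 0"
proof -
  obtain c where "c \<in> l1_space X" "f = kernel_sum X K c"
    using assms(2) by (auto simp: BK_def)
  then show ?thesis
    using BK_norm_kernel_sum [OF assms(1)]
    by (simp add: l1_norm_def infsum_nonneg norm1_nonneg)
qed

definition span_element ::
    "'x set \<Rightarrow> ('x \<Rightarrow> 'x \<Rightarrow> real ^ 'd ^ 'd) \<Rightarrow> nat \<Rightarrow> (nat \<Rightarrow> 'x) \<Rightarrow> (nat \<Rightarrow> real ^ 'd)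
      \<Rightarrow> 'x \<Rightarrow> real ^ 'd"
  where "span_element X K m x c = (\<lambda>z\<in>X. \<Sum>j=1..m. K (x j) z *v c j)"

lemma kernel_span_eq: "kernel_span X K m x = range (span_element X K m x)"
  by (simp add: kernel_span_def span_element_def [abs_def])

lemma span_element_in_BK:
  fixes K :: "'x \<Rightarrow> 'x \<Rightarrow> real ^ 'd ^ 'd"
  assumes adm: "admissible_kernel X K" and x: "distinct_points X {1..m} x"
  shows "span_element X K m x c \<in> BK X K"
    and "BK_norm X K (span_element X K m x c) = (\<Sum>j=1..m. norm1 (c j))"
proof -
  \<comment> \<open>Extension of the finite coefficient list by 0 to a family on X; distinctness of
    the points makes \<open>inv_into\<close> return the right index.\<close>
  define c' where "c' t = (if t \<in> x ` {1..m} then c (inv_into {1..m} x t) else 0)" for t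
  have sub: "x ` {1..m} \<subseteq> X" and inj: "inj_on x {1..m}"
    using x by (auto simp: distinct_points_def)
  have c'_x: "c' (x j) = c j" if "j \<in> {1..m}" for j
    using that inj by (simp add: c'_def)
  \<comment> \<open>Kept generic in \<open>g\<close> and its codomain to serve both the kernel sum
    and the norm.\<close>
  have infsum_eq: "(\<Sum>\<^sub>\<infinity>t\<in>X. g t (c' t)) = (\<Sum>j=1..m. g (x j) (c j))"
    if "\<And>t. g t 0 = 0" for g :: "'x \<Rightarrow> real ^ 'd \<Rightarrow> 'b::{topological_comm_monoid_add, t2_space}"
  proof -
    have "(\<Sum>\<^sub>\<infinity>t\<in>X. g t (c' t)) = (\<Sum>\<^sub>\<infinity>t\<in>x ` {1..m}. g t (c' t))"
      using sub that by (intro infsum_cong_neutral) (auto simp: c'_def)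
    also have "\<dots> = (\<Sum>j=1..m. g (x j) (c' (x j)))"
      by (simp only: infsum_finite finite_imageI finite_atLeastAtMost sum.reindex [OF inj] comp_def)
    also have "\<dots> = (\<Sum>j=1..m. g (x j) (c j))"
      using c'_x by (intro sum.cong) auto
    finally show ?thesis .
  qed
  have "(\<lambda>t. norm1 (c' t)) summable_on x ` {1..m}"
    by simp
  then have "(\<lambda>t. norm1 (c' t)) summable_on X"
    by (rule summable_on_cong_neutral [THEN iffD1, rotated -1]) (use sub in \<open>auto simp: c'_def\<close>)
  then have l1: "c' \<in> l1_space X"
    by (simp add: l1_space_def)
  have eq: "span_element X K m x c = kernel_sum X K c'"
  proof
    fix z
    show "span_element X K m x c z = kernel_sum X K c' z"
    proof (cases "z \<in> X")
      case True
      then show ?thesis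
        using infsum_eq [of "\<lambda>t v. K t z *v v"] by (simp add: kernel_sum_apply span_element_def)
    qed (simp add: span_element_def kernel_sum_def)
  qed
  show "span_element X K m x c \<in> BK X K"
    using eq l1 by (auto simp: BK_def)
  show "BK_norm X K (span_element X K m x c) = (\<Sum>j=1..m. norm1 (c j))"
    unfolding eq BK_norm_kernel_sum [OF adm l1] l1_norm_def
    using infsum_eq [of "\<lambda>_. norm1"] by simp
qed

lemma sample_in_block_vecs: "sample m x f \<in> block_vecs m"
  by (simp add: sample_def block_vecs_def)

lemma sample_span_element:
  assumes "distinct_points X {1..m} x" "j \<in> {1..m}"
  shows "sample m x (span_element X K m x c) j $ a =
    (\<Sum>q\<in>{1..m} \<times> UNIV. kernel_matrix K x (j, a) q * c (fst q) $ snd q)"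
proof -
  have "x j \<in> X"
    using assms by (auto simp: distinct_points_def)
  then show ?thesis
    unfolding kernel_matrix_mult using assms(2) by (simp add: sample_def span_element_def)
qed

section \<open>The two representer theorems\<close>

lemma representer_reg_network_if_min_norm:
  fixes K :: "'x \<Rightarrow> 'x \<Rightarrow> real ^ 'd ^ 'd"
  assumes adm: "admissible_kernel X K" and rep: "representer_min_norm X K"
    and ex: "\<And>m x (y :: nat \<Rightarrow> real ^ 'd) L \<phi> lam.
      sampling_data X m x y \<Longrightarrow> loss_function m L \<Longrightarrow> regularizer \<phi> \<Longrightarrow> lam > 0 \<Longrightarrow>
      \<exists>f. reg_network_minimizer X K m x y L \<phi> lam f"
  shows "representer_reg_network X K"
  unfolding representer_reg_network_def
proof (intro allI impI)
  fix m x \<phi> and y :: "nat \<Rightarrow> real ^ 'd" and lam :: real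
    and L :: "(nat \<Rightarrow> real ^ 'd) \<Rightarrow> (nat \<Rightarrow> real ^ 'd) \<Rightarrow> real"
  assume data: "sampling_data X m x y" and L: "loss_function m L"
    and \<phi>: "regularizer \<phi>" and lam: "lam > 0"
  obtain f where f: "reg_network_minimizer X K m x y L \<phi> lam f"
    using ex [OF data L \<phi> lam] by blast
  then have f_BK: "f \<in> BK X K"
    by (simp add: reg_network_minimizer_def is_arg_min_def)
  have "sampling_data X m x (sample m x f)"
    using data sample_in_block_vecs by (auto simp: sampling_data_def)
  then obtain g where g: "g \<in> kernel_span X K m x" "min_norm_minimizer X K m x (sample m x f) g"
    using rep unfolding representer_min_norm_def by blast
  from g(2) have g_BK: "g \<in> BK X K" and g_sample: "sample m x g = sample m x f"
    by (auto simp: min_norm_minimizer_def is_arg_min_def interpolants_def)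
  have "BK_norm X K g \<le> BK_norm X K f"
    using g(2) f_BK by (auto simp: min_norm_minimizer_def is_arg_min_linorder interpolants_def)
  \<comment> \<open>The regularizer is monotone only on \<open>{0..}\<close>, hence the appeal to
    nonnegativity of the norm.\<close>
  then have "\<phi> (BK_norm X K g) \<le> \<phi> (BK_norm X K f)"
    using \<phi> BK_norm_nonneg [OF adm] g_BK f_BK
    by (auto simp: regularizer_def intro: mono_onD)
  then have "lam * \<phi> (BK_norm X K g) \<le> lam * \<phi> (BK_norm X K f)"
    using lam by simp
  then have "reg_network_minimizer X K m x y L \<phi> lam g"
    using f g_BK g_sample unfolding reg_network_minimizer_def is_arg_min_linorder
    by (smt (verit))
  then show "\<exists>f\<in>kernel_span X K m x. reg_network_minimizer X K m x y L \<phi> lam f"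
    using g(1) by blast
qed

lemma loss_function_abs_linear:
  fixes B :: "nat \<times> 'd::finite \<Rightarrow> nat \<times> 'd \<Rightarrow> real"
  shows "loss_function m (\<lambda>s t :: nat \<Rightarrow> real ^ 'd. \<Sum>p\<in>{1..m} \<times> UNIV.
    \<bar>\<Sum>q\<in>{1..m} \<times> UNIV. B p q * (s (fst q) $ snd q - t (fst q) $ snd q)\<bar>)"
proof -
  have fst: "continuous_on T (\<lambda>u. fst u j)"
    for T :: "((nat \<Rightarrow> real ^ 'd) \<times> (nat \<Rightarrow> real ^ 'd)) set" and j
    by (rule continuous_on_product_then_coordinatewise
        [OF continuous_on_fst [OF continuous_on_id]])
  have snd: "continuous_on T (\<lambda>u. snd u j)"
    for T :: "((nat \<Rightarrow> real ^ 'd) \<times> (nat \<Rightarrow> real ^ 'd)) set" and j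
    by (rule continuous_on_product_then_coordinatewise
        [OF continuous_on_snd [OF continuous_on_id]])
  show ?thesis
    unfolding loss_function_def case_prod_beta
    by (auto intro!: continuous_intros fst snd sum_nonneg)
qed

lemma representer_min_norm_if_reg_network:
  fixes K :: "'x \<Rightarrow> 'x \<Rightarrow> real ^ 'd ^ 'd"
  assumes adm: "admissible_kernel X K" and rep: "representer_reg_network X K"
  shows "representer_min_norm X K"
  unfolding representer_min_norm_def
proof (intro allI impI)
  fix m x and y :: "nat \<Rightarrow> real ^ 'd"
  assume data: "sampling_data X m x y"
  then have m: "m \<ge> 1" and x: "distinct_points X {1..m} x" and y: "y \<in> block_vecs m"
    by (auto simp: sampling_data_def)
  define I :: "(nat \<times> 'd) set" where "I = {1..m} \<times> UNIV"
  have "finite I"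
    by (simp add: I_def)
  then obtain B where
    BM: "\<And>v p. p \<in> I \<Longrightarrow> (\<Sum>q\<in>I. B p q * (\<Sum>r\<in>I. kernel_matrix K x q r * v r)) = v p" and
    MB: "\<And>v p. p \<in> I \<Longrightarrow> (\<Sum>q\<in>I. kernel_matrix K x p q * (\<Sum>r\<in>I. B q r * v r)) = v p"
    using nonsingular_on_inverse [of I "kernel_matrix K x"] admissible_nonsingular [OF adm m x]
    unfolding I_def by blast
  \<comment> \<open>The blocks of K[x]^{-1} y, the coefficients of the interpolant in the span;
    \<open>MB\<close> verifies the interpolation.\<close>
  define c :: "nat \<Rightarrow> real ^ 'd" where "c k = (\<chi> b. \<Sum>r\<in>I. B (k, b) r * y (fst r) $ snd r)" for k
  have c: "c (fst q) $ snd q = (\<Sum>r\<in>I. B q r * y (fst r) $ snd r)" for q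
    by (simp add: c_def)
  define f where "f = span_element X K m x c"
  have "sample m x f j = y j" for j
  proof (cases "j \<in> {1..m}")
    case True
    then show ?thesis
      using sample_span_element [OF x True, of K c] MB [of "(j, a)" "\<lambda>r. y (fst r) $ snd r" for a]
      by (simp add: f_def vec_eq_iff I_def c [unfolded I_def])
  next
    \<comment> \<open>Outside \<open>{1..m}\<close> both sides are \<open>undefined\<close>, by
      extensionality.\<close>
    case False
    then show ?thesis
      using y by (auto simp: sample_def block_vecs_def PiE_def extensional_def)
  qed
  then have f_sample: "sample m x f = y" ..
  \<comment> \<open>Weighting the residual by the inverse matrix measures it in coefficients, the
    same scale as the norm on the span, so the penalty is exact already for
    \<open>lam = 1\<close>.\<close>
  define L where "L s t = (\<Sum>p\<in>I. \<bar>\<Sum>q\<in>I. B p q * (s (fst q) $ snd q - t (fst q) $ snd q)\<bar>)"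
    for s t :: "nat \<Rightarrow> real ^ 'd"
  have L: "loss_function m L"
    using loss_function_abs_linear [of m B] by (simp add: L_def [abs_def] I_def)
  have "regularizer (\<lambda>t. t)"
    by (auto simp: regularizer_def mono_on_def filterlim_ident)
  then obtain g where g: "g \<in> kernel_span X K m x"
    "reg_network_minimizer X K m x y L (\<lambda>t. t) 1 g"
    using rep data L unfolding representer_reg_network_def by (meson zero_less_one)
  then obtain b where b: "g = span_element X K m x b"
    by (auto simp: kernel_span_eq)
  have norm_eq: "BK_norm X K (span_element X K m x v) = (\<Sum>p\<in>I. \<bar>v (fst p) $ snd p\<bar>)" for v
    using span_element_in_BK(2) [OF adm x] by (simp add: norm1_def I_def sum.cartesian_product')
  \<comment> \<open>The samples of \<open>g\<close> are K[x] b, so the left inverse turns the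
    residual into b - c.\<close>
  have "(\<Sum>q\<in>I. B p q * (sample m x g (fst q) $ snd q - y (fst q) $ snd q))
      = b (fst p) $ snd p - c (fst p) $ snd p" if "p \<in> I" for p
  proof -
    have "(\<Sum>q\<in>I. B p q * sample m x g (fst q) $ snd q) =
        (\<Sum>q\<in>I. B p q * (\<Sum>r\<in>I. kernel_matrix K x q r * b (fst r) $ snd r))"
      unfolding b I_def
      by (intro sum.cong refl) (auto simp: sample_span_element [OF x])
    then show ?thesis
      using BM [OF that, of "\<lambda>r. b (fst r) $ snd r"]
      by (simp add: c right_diff_distrib sum_subtractf)
  qed
  then have L_g: "L (sample m x g) y = (\<Sum>p\<in>I. \<bar>b (fst p) $ snd p - c (fst p) $ snd p\<bar>)"
    by (simp add: L_def)
  \<comment> \<open>Entrywise triangle inequality |c| \<le> |b - c| + |b|.\<close>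
  have "BK_norm X K f \<le> L (sample m x g) y + BK_norm X K g"
    unfolding f_def L_g unfolding b norm_eq sum.distrib [symmetric]
    by (intro sum_mono) linarith
  \<comment> \<open>Minimality of \<open>g\<close> against \<open>h\<close>, whose loss is
    \<open>L y y = 0\<close>.\<close>
  also have "\<dots> \<le> BK_norm X K h" if "h \<in> interpolants X K m x y" for h
    using g(2) that L y
    by (auto simp: reg_network_minimizer_def is_arg_min_linorder interpolants_def loss_function_def)
  finally have "min_norm_minimizer X K m x y f"
    using span_element_in_BK(1) [OF adm x] f_sample
    by (auto simp: min_norm_minimizer_def is_arg_min_linorder interpolants_def f_def)
  then show "\<exists>f\<in>kernel_span X K m x. min_norm_minimizer X K m x y f"
    by (auto simp: f_def kernel_span_eq)
qed

theorem theorem3p3: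
  fixes X :: "'x set" and K :: "'x \<Rightarrow> 'x \<Rightarrow> real ^ 'd ^ 'd"
  assumes "X \<noteq> {}"
    and "admissible_kernel X K"
    and "\<forall>m x y. sampling_data X m x y \<longrightarrow> (\<exists>f. min_norm_minimizer X K m x y f)"
    and "\<forall>m x y L \<phi> lam.
          sampling_data X m x y \<longrightarrow> loss_function m L \<longrightarrow> regularizer \<phi> \<longrightarrow> lam > 0 \<longrightarrow>
          (\<exists>f. reg_network_minimizer X K m x y L \<phi> lam f)"
  shows "representer_reg_network X K \<longleftrightarrow> representer_min_norm X K"
  using assms(2,4) representer_min_norm_if_reg_network representer_reg_network_if_min_norm by blast

end
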